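(* Every vertex-transitive graph $\Gamma$ with countably infinitely many vertices and connectivity $1$ has distinguishing number $2$.
   Context: Graphs are simple. A connected graph $\Gamma$ has connectivity $1$ if there exists a vertex $\alpha\in V\Gamma$ such that $\Gamma\setminus\{\alpha\}$ is not connected. The distinguishing number of a graph is the least number of colors needed to color its vertices so that no non-identity automorphism preserves every color class setwise. *)

theory Defs
  imports
    "Graph_Theory.Digraph_Component"
    "HOL-Combinatorics.Permutations"
    "HOL-Library.Countable_Set"
    "HOL-Library.Extended_Nat"
begin

text \<open>
  A simple graph, finite or infinite, is a \<open>pair_bidirected_digraph\<close>: an irreflexive symmetric
  set of ordered pairs of vertices, each undirected edge being represented by its two orientations.
\<close>

text \<open>
  Since \<open>f permutes pverts G\<close> makes \<open>f\<close> the identity outside the vertex set, the identity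
  automorphism is exactly \<open>id\<close>.
\<close>

definition automorphism :: "'a pair_pre_digraph \<Rightarrow> ('a \<Rightarrow> 'a) \<Rightarrow> bool" where
  "automorphism G f \<longleftrightarrow>
     f permutes pverts G \<and>
     (\<forall>u\<in>pverts G. \<forall>v\<in>pverts G. (f u, f v) \<in> parcs G \<longleftrightarrow> (u, v) \<in> parcs G)"

definition vertex_transitive :: "'a pair_pre_digraph \<Rightarrow> bool" where
  "vertex_transitive G \<longleftrightarrow>
     (\<forall>u\<in>pverts G. \<forall>v\<in>pverts G. \<exists>f. automorphism G f \<and> f u = v)"

text \<open>
  The null graph does not count as \<open>connected\<close> in the library, so a one-vertex graph satisfies
  the following predicate; on graphs with at least two vertices this convention plays no role.
\<close>

definition connectivity_one :: "'a pair_pre_digraph \<Rightarrow> bool" where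
  "connectivity_one G \<longleftrightarrow>
     connected (with_proj G) \<and>
     (\<exists>a\<in>pverts G. \<not> connected (pre_digraph.del_vert (with_proj G) a))"

definition distinguishing_coloring :: "'a pair_pre_digraph \<Rightarrow> ('a \<Rightarrow> 'c) \<Rightarrow> bool" where
  "distinguishing_coloring G c \<longleftrightarrow>
     (\<forall>f. automorphism G f \<and>
          (\<forall>i. f ` {v \<in> pverts G. c v = i} = {v \<in> pverts G. c v = i}) \<longrightarrow> f = id)"

text \<open>The value is \<open>\<infinity>\<close> if no finite number of colors suffices.\<close>

definition distinguishing_number :: "'a pair_pre_digraph \<Rightarrow> enat" where
  "distinguishing_number G =
     Inf {enat k | k. \<exists>c :: 'a \<Rightarrow> nat. c ` pverts G \<subseteq> {..<k} \<and> distinguishing_coloring G c}"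

end

theory Submission
  imports Defs
begin

text \<open>
  Fix a root \<open>r\<close> and say that \<open>v\<close> separates \<open>r\<close> from \<open>x\<close> if every walk from \<open>r\<close> to \<open>x\<close> meets \<open>v\<close>.
  By transitivity every vertex is a cut vertex, so beyond each vertex \<open>v\<close>, that is, among the
  vertices separated from \<open>r\<close> by \<open>v\<close>, there are vertices arbitrarily far from \<open>r\<close>.
  Enumerate the vertices as \<open>v\<^sub>0, v\<^sub>1, \<dots>\<close> and choose \<open>u\<^sub>n\<close> beyond \<open>v\<^sub>n\<close> so that the distances from
  \<open>r\<close> to the \<open>u\<^sub>n\<close> increase in steps of at least 2, starting above 2. Color \<open>r\<close>, one neighbor \<open>s\<close> of
  \<open>r\<close> and all the \<open>u\<^sub>n\<close> black, everything else white. Then \<open>{r, s}\<close> is the only black edge, so a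
  color-preserving automorphism \<open>f\<close> preserves it. If \<open>f\<close> swapped \<open>r\<close> and \<open>s\<close>, the distance from \<open>r\<close>
  to \<open>u\<^sub>n\<close> would change by at most 1, so \<open>f\<close> would fix each \<open>u\<^sub>n\<close> and \<open>u\<^sub>n\<close> would be equidistant from
  \<open>r\<close> and \<open>s\<close>, which fails when \<open>v\<^sub>n = s\<close>. So \<open>f\<close> fixes \<open>r\<close>, hence every \<open>u\<^sub>n\<close>. Finally both \<open>v\<^sub>n\<close> and
  \<open>f v\<^sub>n\<close> lie on a geodesic from \<open>r\<close> to \<open>u\<^sub>n\<close> at the same distance from \<open>r\<close>, so they are equal.
\<close>

section \<open>Distances, geodesics and separating vertices in a relation\<close>

definition rel_dist :: "'a rel \<Rightarrow> 'a \<Rightarrow> 'a \<Rightarrow> nat" where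
  "rel_dist E x y = (LEAST n. (x, y) \<in> E ^^ n)"

text \<open>Both ends count: \<open>x\<close> and \<open>y\<close> themselves separate \<open>x\<close> from \<open>y\<close>.\<close>

definition separates :: "'a rel \<Rightarrow> 'a \<Rightarrow> 'a \<Rightarrow> 'a \<Rightarrow> bool" where
  "separates E x v y \<longleftrightarrow> x = v \<or> (x, y) \<notin> (Restr E (- {v}))\<^sup>*"

lemma rel_dist_le: "(x, y) \<in> E ^^ n \<Longrightarrow> rel_dist E x y \<le> n"
  unfolding rel_dist_def by (rule Least_le)

lemma relpow_rel_dist: "(x, y) \<in> E\<^sup>* \<Longrightarrow> (x, y) \<in> E ^^ rel_dist E x y"
  unfolding rel_dist_def by (rule LeastI_ex) (simp add: rtrancl_power)

lemma rel_dist_self [simp]: "rel_dist E x x = 0"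
  using rel_dist_le[of x x 0 E] by simp

lemma rel_dist_step_right:
  assumes "(x, y) \<in> E\<^sup>*" "(y, z) \<in> E"
  shows "rel_dist E x z \<le> Suc (rel_dist E x y)"
  using relpow_rel_dist[OF assms(1)] assms(2) by (intro rel_dist_le) auto

lemma rel_dist_step_left:
  assumes "(x, y) \<in> E" "(y, z) \<in> E\<^sup>*"
  shows "rel_dist E x z \<le> Suc (rel_dist E y z)"
  using relpow_rel_dist[OF assms(2)] assms(1) by (intro rel_dist_le) (rule relpow_Suc_I2)

lemma relpow_segment:
  assumes "\<And>i. i < n \<Longrightarrow> (p i, p (Suc i)) \<in> E" "i \<le> j" "j \<le> n"
  shows "(p i, p j) \<in> E ^^ (j - i)"
  unfolding relpow_fun_conv
  using assms by (intro exI[of _ "\<lambda>k. p (i + k)"]) auto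

text \<open>A walk avoiding \<open>v\<close> would stay inside the restricted relation, by induction
  along the walk.\<close>

lemma separates_on_walk:
  assumes sep: "separates E (p 0) v (p n)"
    and walk: "\<And>i. i < n \<Longrightarrow> (p i, p (Suc i)) \<in> E"
  obtains i where "i \<le> n" "p i = v"
proof (rule ccontr)
  assume "\<not> thesis"
  with that have avoid: "p i \<noteq> v" if "i \<le> n" for i
    using \<open>i \<le> n\<close> by blast
  have "(p 0, p k) \<in> (Restr E (- {v}))\<^sup>*" if "k \<le> n" for k
    using that
  proof (induction k)
    case (Suc k)
    have "(p k, p (Suc k)) \<in> Restr E (- {v})"
      using walk[of k] avoid[of k] avoid[of "Suc k"] Suc.prems by auto
    with Suc show ?case by (meson Suc_leD rtrancl.rtrancl_into_rtrancl)
  qed simp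
  with sep avoid[of 0] show False by (auto simp: separates_def)
qed

text \<open>A shorter way to an intermediate vertex would shorten the whole walk, so a walk of
  minimal length realises all distances from \<open>x\<close>. The bound on distances to
  \<open>y\<close> comes from the rest of the walk.\<close>

lemma geodesic:
  assumes "(x, y) \<in> E\<^sup>*"
  obtains p where "p 0 = x" "p (rel_dist E x y) = y"
    "\<And>i. i < rel_dist E x y \<Longrightarrow> (p i, p (Suc i)) \<in> E"
    "\<And>i. i \<le> rel_dist E x y \<Longrightarrow> rel_dist E x (p i) = i"
    "\<And>i. i \<le> rel_dist E x y \<Longrightarrow> rel_dist E (p i) y \<le> rel_dist E x y - i"
proof -
  let ?n = "rel_dist E x y"
  obtain p where p: "p 0 = x" "p ?n = y" "\<And>i. i < ?n \<Longrightarrow> (p i, p (Suc i)) \<in> E"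
    using relpow_rel_dist[OF assms] unfolding relpow_fun_conv by blast
  have seg: "(p i, p j) \<in> E ^^ (j - i)" if "i \<le> j" "j \<le> ?n" for i j
    using relpow_segment[of ?n p E i j] p(3) that by blast
  have "rel_dist E x (p i) = i" if i: "i \<le> ?n" for i
  proof (rule antisym)
    have xi: "(x, p i) \<in> E ^^ i" using seg[of 0 i] i p(1) by simp
    then show "rel_dist E x (p i) \<le> i" by (rule rel_dist_le)
    have "(x, p i) \<in> E ^^ rel_dist E x (p i)"
      using xi by (intro relpow_rel_dist relpow_imp_rtrancl)
    moreover have "(p i, y) \<in> E ^^ (?n - i)" using seg[of i ?n] i p(2) by simp
    ultimately have "(x, y) \<in> E ^^ (rel_dist E x (p i) + (?n - i))"
      unfolding relpow_add by blast
    then have "?n \<le> rel_dist E x (p i) + (?n - i)" by (rule rel_dist_le)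
    with i show "i \<le> rel_dist E x (p i)" by linarith
  qed
  moreover have "rel_dist E (p i) y \<le> ?n - i" if "i \<le> ?n" for i
    using seg[of i ?n] that p(2) by (intro rel_dist_le) simp
  ultimately show thesis using that p by blast
qed

lemma separates_rel_dist_less:
  assumes "(x, y) \<in> E\<^sup>*" "separates E x v y" "v \<noteq> y"
  shows "rel_dist E x v < rel_dist E x y"
proof -
  obtain p where p: "p 0 = x" "p (rel_dist E x y) = y"
    "\<And>i. i < rel_dist E x y \<Longrightarrow> (p i, p (Suc i)) \<in> E"
    "\<And>i. i \<le> rel_dist E x y \<Longrightarrow> rel_dist E x (p i) = i"
    using geodesic[OF assms(1)] by metis
  obtain i where "i \<le> rel_dist E x y" "p i = v"
    using separates_on_walk[of E p v "rel_dist E x y"] p assms(2) by metis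
  with p assms(3) show ?thesis by (metis le_neq_implies_less)
qed

lemma separates_rel_dist_less':
  assumes "(x, y) \<in> E\<^sup>*" "separates E x v y" "v \<noteq> x"
  shows "rel_dist E v y < rel_dist E x y"
proof -
  obtain p where p: "p 0 = x" "p (rel_dist E x y) = y"
    "\<And>i. i < rel_dist E x y \<Longrightarrow> (p i, p (Suc i)) \<in> E"
    "\<And>i. i \<le> rel_dist E x y \<Longrightarrow> rel_dist E (p i) y \<le> rel_dist E x y - i"
    using geodesic[OF assms(1)] by metis
  obtain i where i: "i \<le> rel_dist E x y" "p i = v"
    using separates_on_walk[of E p v "rel_dist E x y"] p assms(2) by metis
  with p(1) assms(3) have "i \<noteq> 0" by metis
  with p(4)[OF i(1)] i show ?thesis by simp
qed

text \<open>Both vertices lie on one geodesic from \<open>x\<close> to \<open>y\<close>, which has a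
  single vertex at each distance from \<open>x\<close>.\<close>

lemma separates_unique_at_dist:
  assumes "(x, y) \<in> E\<^sup>*" "separates E x v y" "separates E x w y"
    and "rel_dist E x v = rel_dist E x w"
  shows "v = w"
proof -
  obtain p where p: "p 0 = x" "p (rel_dist E x y) = y"
    "\<And>i. i < rel_dist E x y \<Longrightarrow> (p i, p (Suc i)) \<in> E"
    "\<And>i. i \<le> rel_dist E x y \<Longrightarrow> rel_dist E x (p i) = i"
    using geodesic[OF assms(1)] by metis
  obtain i where "i \<le> rel_dist E x y" "p i = v"
    using separates_on_walk[of E p v "rel_dist E x y"] p assms(2) by metis
  moreover obtain j where "j \<le> rel_dist E x y" "p j = w"
    using separates_on_walk[of E p w "rel_dist E x y"] p assms(3) by metis
  ultimately show ?thesis using p(4) assms(4) by metis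
qed

lemma separates_trans:
  assumes "separates E x v y" "separates E x y z"
  shows "separates E x v z"
proof (cases "x = v \<or> x = y")
  case True
  with assms(1) show ?thesis by (auto simp: separates_def)
next
  case False
  \<comment> \<open>Along a walk avoiding \<open>v\<close>, either \<open>y\<close> has been
    reached, against the first assumption, or the walk has avoided \<open>y\<close> so far, against
    the second.\<close>
  have "(x, y) \<in> (Restr E (- {v}))\<^sup>* \<or> (x, z) \<in> (Restr E (- {y}))\<^sup>*"
    if "(x, z) \<in> (Restr E (- {v}))\<^sup>*"
    using that
  proof (induction rule: rtrancl_induct)
    case (step a b)
    show ?case
    proof (cases "a = y \<or> b = y")
      case True
      with step.hyps show ?thesis by (metis rtrancl.rtrancl_into_rtrancl)
    next
      case False
      with step.hyps(2) have "(a, b) \<in> Restr E (- {y})" by blast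
      with step.IH show ?thesis by (metis rtrancl.rtrancl_into_rtrancl)
    qed
  qed simp
  with assms False show ?thesis unfolding separates_def by blast
qed

text \<open>Otherwise a walk from \<open>x\<close> back to \<open>r\<close> and on to
  \<open>y\<close> would avoid \<open>v\<close>.\<close>

lemma separates_root_change:
  assumes "sym E" "separates E x v y" "x \<noteq> v" "r \<noteq> v"
  shows "separates E r v x \<or> separates E r v y"
proof (rule ccontr)
  assume "\<not> ?thesis"
  then have "(r, x) \<in> (Restr E (- {v}))\<^sup>*" "(r, y) \<in> (Restr E (- {v}))\<^sup>*"
    by (auto simp: separates_def)
  moreover have "sym (Restr E (- {v}))" using assms(1) by (auto simp: sym_def)
  then have "sym ((Restr E (- {v}))\<^sup>*)" by (rule sym_rtrancl)
  ultimately have "(x, y) \<in> (Restr E (- {v}))\<^sup>*"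
    by (meson rtrancl_trans symD)
  with assms show False by (auto simp: separates_def)
qed

section \<open>Automorphisms of a relation\<close>

text \<open>\<open>f\<close> is a bijection of the whole type, since a graph automorphism fixes
  everything outside the vertex set.\<close>

locale rel_automorphism =
  fixes E :: "'a rel" and f :: "'a \<Rightarrow> 'a"
  assumes bij: "bij f" and edge_iff: "(f x, f y) \<in> E \<longleftrightarrow> (x, y) \<in> E"
begin

lemma relpow_iff: "(f x, f y) \<in> E ^^ n \<longleftrightarrow> (x, y) \<in> E ^^ n"
proof (induction n arbitrary: y)
  case 0
  then show ?case using bij by (simp add: bij_is_inj inj_eq)
next
  case (Suc n)
  have "(\<exists>z. (f x, z) \<in> E ^^ n \<and> (z, f y) \<in> E) \<longleftrightarrow> (\<exists>z. (f x, f z) \<in> E ^^ n \<and> (f z, f y) \<in> E)"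
    using bij by (metis bij_pointE)
  then show ?case by (simp add: relcomp_unfold Suc edge_iff)
qed

lemma rel_dist_image [simp]: "rel_dist E (f x) (f y) = rel_dist E x y"
  by (simp add: rel_dist_def relpow_iff)

end

lemma separates_image:
  assumes "rel_automorphism E f" "separates E x v y"
  shows "separates E (f x) (f v) (f y)"
proof -
  interpret rel_automorphism E f by fact
  have inj: "f a = f b \<longleftrightarrow> a = b" for a b using bij by (simp add: bij_is_inj inj_eq)
  have "(x, b) \<in> (Restr E (- {v}))\<^sup>*" if "(f x, f b) \<in> (Restr E (- {f v}))\<^sup>*" for b
  proof -
    \<comment> \<open>The induction needs a free endpoint \<open>c\<close>. Each vertex met is an
      image under \<open>f\<close>, so the walk can be pulled back edge by edge.\<close>
    have "\<forall>b. c = f b \<longrightarrow> (x, b) \<in> (Restr E (- {v}))\<^sup>*"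
      if "(f x, c) \<in> (Restr E (- {f v}))\<^sup>*" for c
      using that
    proof (induction rule: rtrancl_induct)
      case base
      then show ?case by (simp add: inj)
    next
      case (step c d)
      show ?case
      proof (intro allI impI)
        fix b assume d: "d = f b"
        obtain a where a: "c = f a" using bij by (metis bij_pointE)
        with step d have "(a, b) \<in> Restr E (- {v})" by (auto simp: edge_iff)
        with step.IH a show "(x, b) \<in> (Restr E (- {v}))\<^sup>*"
          by (metis rtrancl.rtrancl_into_rtrancl)
      qed
    qed
    with that show ?thesis by blast
  qed
  with assms(2) show ?thesis by (auto simp: separates_def inj)
qed

section \<open>From the digraph notions to relations\<close>

lemma rtrancl_on_eq_rtrancl:
  assumes "E \<subseteq> V \<times> V" "x \<in> V"
  shows "(x, y) \<in> rtrancl_on V E \<longleftrightarrow> (x, y) \<in> E\<^sup>*"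
proof
  assume "(x, y) \<in> E\<^sup>*"
  then show "(x, y) \<in> rtrancl_on V E"
    by (induction rule: rtrancl_induct) (use assms in \<open>auto intro: rtrancl_on_into_rtrancl_on\<close>)
qed (rule rtrancl_on_rtranclI)

text \<open>On a symmetric digraph, the symmetric closure in the definition of
  \<open>connected\<close> changes nothing.\<close>

lemma connected_conv_rtrancl:
  assumes "wf_digraph H" "symmetric H"
  shows "connected H \<longleftrightarrow> verts H \<noteq> {} \<and> (\<forall>u\<in>verts H. \<forall>v\<in>verts H. (u, v) \<in> (arcs_ends H)\<^sup>*)"
proof -
  interpret wf_digraph H by fact
  have "arcs_ends H \<subseteq> verts H \<times> verts H" by (auto dest: adj_in_verts)
  then show ?thesis
    unfolding connected_def strongly_connected_def
    using reachable_mk_symmetric_eq[OF assms(2)] rtrancl_on_eq_rtrancl[of "arcs_ends H" "verts H"]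
    by (auto simp: reachable_def)
qed

context
  fixes G :: "'a pair_pre_digraph"
  assumes G: "pair_bidirected_digraph G"
begin

interpretation pair_bidirected_digraph G by (rule G)

lemma sym_parcs: "sym (parcs G)"
  using sym_arcs by (simp add: symmetric_def)

lemma parcs_subset: "parcs G \<subseteq> pverts G \<times> pverts G"
  using in_arcsD1 in_arcsD2 by auto

lemma rel_automorphism_parcs:
  assumes "automorphism G f"
  shows "rel_automorphism (parcs G) f"
proof
  show "bij f" using assms permutes_bij unfolding automorphism_def by blast
  fix x y
  have "f z \<in> pverts G \<longleftrightarrow> z \<in> pverts G" for z
    using assms permutes_in_image unfolding automorphism_def by metis
  then show "(f x, f y) \<in> parcs G \<longleftrightarrow> (x, y) \<in> parcs G"
    using assms parcs_subset unfolding automorphism_def by blast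
qed

lemma connected_rtrancl:
  assumes "connected (with_proj G)" "u \<in> pverts G" "v \<in> pverts G"
  shows "(u, v) \<in> (parcs G)\<^sup>*"
  using assms connected_conv_rtrancl[of "with_proj G"] wf_digraph sym_arcs by simp

lemma cut_vertex_separates:
  assumes "\<not> connected (pre_digraph.del_vert (with_proj G) a)" "infinite (pverts G)"
  obtains x y where "x \<in> pverts G" "y \<in> pverts G" "x \<noteq> a" "y \<noteq> a" "separates (parcs G) x a y"
proof -
  let ?H = "pre_digraph.del_vert (with_proj G) a"
  have verts: "verts ?H = pverts G - {a}" by (simp add: verts_del_vert)
  have ends: "arcs_ends ?H = Restr (parcs G) (- {a})"
    by (auto simp: arcs_ends_conv arcs_del_vert tail_del_vert head_del_vert)
  have "wf_digraph ?H" by (rule wf_digraph_del_vert)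
  moreover have "symmetric ?H"
    unfolding symmetric_def ends using sym_parcs by (auto simp: sym_def)
  \<comment> \<open>This rules out the null graph, so disconnectedness must come from two vertices
    without a walk between them.\<close>
  moreover have "verts ?H \<noteq> {}" using assms(2) unfolding verts
    by (metis finite.emptyI infinite_remove)
  ultimately have "\<exists>x\<in>pverts G - {a}. \<exists>y\<in>pverts G - {a}. (x, y) \<notin> (Restr (parcs G) (- {a}))\<^sup>*"
    using assms(1) connected_conv_rtrancl[of ?H] unfolding verts ends by blast
  then show thesis using that by (auto simp: separates_def)
qed

end

section \<open>Far vertices beyond a vertex, and rigidity of the black set\<close>

text \<open>Each \<open>u\<close> beyond \<open>v\<close> is itself a cut vertex, so some
  \<open>w\<close> lies beyond \<open>u\<close>. It is strictly farther from \<open>r\<close> and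
  still beyond \<open>v\<close>.\<close>

lemma exists_separated_far:
  assumes "sym E" and conn: "\<And>x y. x \<in> V \<Longrightarrow> y \<in> V \<Longrightarrow> (x, y) \<in> E\<^sup>*"
    and cut: "\<And>v. v \<in> V \<Longrightarrow> \<exists>x\<in>V. \<exists>y\<in>V. x \<noteq> v \<and> y \<noteq> v \<and> separates E x v y"
    and "r \<in> V" "v \<in> V"
  shows "\<exists>u\<in>V. separates E r v u \<and> N \<le> rel_dist E r u"
proof (induction N)
  case 0
  show ?case using \<open>v \<in> V\<close> by (auto simp: separates_def intro!: bexI[of _ v] elim: rtranclE)
next
  case (Suc N)
  then obtain u where u: "u \<in> V" "separates E r v u" "N \<le> rel_dist E r u" by blast
  obtain x y where xy: "x \<in> V" "y \<in> V" "x \<noteq> u" "y \<noteq> u" "separates E x u y"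
    using cut[OF u(1)] by blast
  have "separates E r u x \<or> separates E r u y"
    using separates_root_change[OF assms(1) xy(5,3), of r] by (auto simp: separates_def)
  with xy obtain w where w: "w \<in> V" "w \<noteq> u" "separates E r u w" by blast
  then have "rel_dist E r u < rel_dist E r w"
    using separates_rel_dist_less conn \<open>r \<in> V\<close> by metis
  moreover have "separates E r v w" using separates_trans u(2) w(3) by metis
  ultimately show ?case using w(1) u(3) by (intro bexI[of _ w]) auto
qed

lemma black_vertices_rigid:
  fixes u v :: "nat \<Rightarrow> 'a"
  assumes V: "\<And>x y. x \<in> V \<Longrightarrow> y \<in> V \<Longrightarrow> (x, y) \<in> E\<^sup>*" and "sym E"
    and rs: "r \<in> V" "s \<in> V" "(r, s) \<in> E" "r \<noteq> s"
    and v: "range v = V"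
    and u: "\<And>n. u n \<in> V" "\<And>n. separates E r (v n) (u n)"
    and far: "\<And>n. 2 < rel_dist E r (u n)"
    and gap: "\<And>m n. m < n \<Longrightarrow> Suc (rel_dist E r (u m)) < rel_dist E r (u n)"
    and f: "rel_automorphism E f" and black: "f ` ({r, s} \<union> range u) = {r, s} \<union> range u"
    and "x \<in> V"
  shows "f x = x"
proof -
  interpret rel_automorphism E f by (rule f)
  have inj: "f a = f b \<longleftrightarrow> a = b" for a b using bij by (simp add: bij_is_inj inj_eq)
  have black': "f b \<in> {r, s} \<union> range u" if "b \<in> {r, s} \<union> range u" for b
    using black that by blast
  \<comment> \<open>Distances of different \<open>u n\<close> differ by at least 2, so a difference
    of at most 1 forces equal indices.\<close>
  have close: "m = n" if "rel_dist E r (u m) \<le> Suc (rel_dist E r (u n))"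
    "rel_dist E r (u n) \<le> Suc (rel_dist E r (u m))" for m n
    using gap[of m n] gap[of n m] that by (cases m n rule: linorder_cases) auto
  have sr: "(s, r) \<in> E" using rs \<open>sym E\<close> by (metis symD)
  have r_s: "rel_dist E r s \<le> 1" using rel_dist_le[of r s 1 E] rs by simp
  have edge_dist: "rel_dist E r b \<le> Suc (rel_dist E r a)" if "(a, b) \<in> E" "a \<in> V" for a b
    using rel_dist_step_right that V rs(1) by metis
  \<comment> \<open>Adjacent vertices differ by at most 1 in distance from \<open>r\<close>. But
    \<open>r\<close> and \<open>s\<close> have distance at most 1, and each \<open>u n\<close> at
    least 3.\<close>
  have black_edge: "{a, b} = {r, s}"
    if ab: "(a, b) \<in> E" "a \<in> {r, s} \<union> range u" "b \<in> {r, s} \<union> range u" "a \<noteq> b" for a b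
  proof -
    have ba: "(b, a) \<in> E" using ab(1) \<open>sym E\<close> by (metis symD)
    have "a \<in> V" "b \<in> V" using ab rs u by auto
    then have d: "rel_dist E r b \<le> Suc (rel_dist E r a)" "rel_dist E r a \<le> Suc (rel_dist E r b)"
      using edge_dist ab(1) ba by auto
    have small: "rel_dist E r c \<le> 1" if "c \<in> {r, s}" for c using that r_s by auto
    have "a \<in> {r, s} \<and> b \<in> {r, s}"
    proof (rule ccontr)
      assume "\<not> ?thesis"
      then consider n where "a = u n" "b \<in> {r, s}" | n where "a \<in> {r, s}" "b = u n"
        | m n where "a = u m" "b = u n"
        using ab(2,3) by blast
      then show False
      proof cases
        case (1 n) with d small[of b] far[of n] show False by simp
      next
        case (2 n) with d small[of a] far[of n] show False by simp
      next
        case (3 m n) with d close[of m n] ab(4) show False by simp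
      qed
    qed
    with ab(4) show ?thesis by auto
  qed
  have "{f r, f s} = {r, s}"
    using black_edge[of "f r" "f s"] rs black' by (simp add: edge_iff inj)
  then consider (fixed) "f r = r" "f s = s" | (swap) "f r = s" "f s = r"
    using rs(4) by (auto simp: doubleton_eq_iff)
  then have fr: "f r = r \<and> f s = s"
  proof cases
    case swap
    \<comment> \<open>For this index \<open>u n\<close> lies beyond \<open>s\<close>, hence is
      closer to \<open>s\<close> than to \<open>r\<close>.\<close>
    obtain n where n: "v n = s" using v rs(2) by (metis rangeE)
    have dist_s: "rel_dist E s (f (u n)) = rel_dist E r (u n)"
      using rel_dist_image[of r "u n"] swap by simp
    have "u n \<noteq> r" "u n \<noteq> s" using far[of n] r_s by auto
    \<comment> \<open>The values \<open>r\<close> and \<open>s\<close> are already taken, so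
      injectivity leaves only some \<open>u m\<close> as the image.\<close>
    then have "f (u n) \<notin> {r, s}" using swap inj by auto
    then obtain m where m: "f (u n) = u m" using black'[of "u n"] by auto
    have "rel_dist E r (u m) \<le> Suc (rel_dist E s (u m))"
      "rel_dist E s (u m) \<le> Suc (rel_dist E r (u m))"
      using rel_dist_step_left rs sr u(1) V by metis+
    then have "m = n" using dist_s m by (intro close) auto
    then have "rel_dist E s (u n) = rel_dist E r (u n)" using dist_s m by simp
    moreover have "rel_dist E s (u n) < rel_dist E r (u n)"
      using separates_rel_dist_less'[of r "u n" E s] V rs u n by metis
    ultimately show ?thesis by simp
  qed simp
  have fu: "f (u n) = u n" for n
  proof -
    have "u n \<noteq> r" "u n \<noteq> s" using far[of n] r_s by auto
    then have "f (u n) \<notin> {r, s}" using fr inj by (metis insertE singletonD)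
    then obtain m where m: "f (u n) = u m" using black'[of "u n"] by auto
    then have "rel_dist E r (u m) = rel_dist E r (u n)"
      using rel_dist_image[of r "u n"] fr by simp
    then show ?thesis using close[of m n] m by simp
  qed
  obtain n where n: "v n = x" using v \<open>x \<in> V\<close> by (metis rangeE)
  have "separates E r (f x) (u n)"
    using separates_image[OF f u(2)[of n]] fr fu n by simp
  moreover have "rel_dist E r (f x) = rel_dist E r x"
    using rel_dist_image[of r x] fr by simp
  ultimately show ?thesis
    using separates_unique_at_dist[of r "u n" E "f x" x] u n V rs(1) by metis
qed

section \<open>The coloring and the distinguishing number\<close>

lemma exists_distinguishing_2_coloring:
  assumes G: "pair_bidirected_digraph G"
    and "countable (pverts G)" and inf: "infinite (pverts G)"
    and trans: "vertex_transitive G"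
    and "connectivity_one G"
  shows "\<exists>c :: 'a \<Rightarrow> nat. c ` pverts G \<subseteq> {..<2} \<and> distinguishing_coloring G c"
proof -
  let ?V = "pverts G" and ?E = "parcs G"
  obtain a where conn: "connected (with_proj G)" and a: "a \<in> ?V"
    "\<not> connected (pre_digraph.del_vert (with_proj G) a)"
    using assms(5) unfolding connectivity_one_def by blast
  note V = connected_rtrancl[OF G conn]
  note sym = sym_parcs[OF G]
  \<comment> \<open>An automorphism taking \<open>a\<close> to \<open>v\<close> carries a pair
    separated by \<open>a\<close> to one separated by \<open>v\<close>.\<close>
  have cut: "\<exists>x\<in>?V. \<exists>y\<in>?V. x \<noteq> v \<and> y \<noteq> v \<and> separates ?E x v y" if "v \<in> ?V" for v
  proof -
    obtain x y where xy: "x \<in> ?V" "y \<in> ?V" "x \<noteq> a" "y \<noteq> a" "separates ?E x a y"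
      using cut_vertex_separates[OF G a(2) inf] by blast
    obtain f where f: "automorphism G f" "f a = v"
      using trans a(1) \<open>v \<in> ?V\<close> unfolding vertex_transitive_def by blast
    have perm: "f permutes ?V" using f(1) by (simp add: automorphism_def)
    have "separates ?E (f x) v (f y)"
      using separates_image[OF rel_automorphism_parcs[OF G f(1)] xy(5)] f(2) by simp
    moreover have "f x \<in> ?V" "f y \<in> ?V" using perm xy by (simp_all add: permutes_in_image)
    moreover have "f x \<noteq> v" "f y \<noteq> v" using perm xy f(2) by (metis permutes_inj injD)+
    ultimately show ?thesis by blast
  qed
  have far: "\<exists>u\<in>?V. separates ?E r v u \<and> N \<le> rel_dist ?E r u" if "r \<in> ?V" "v \<in> ?V" for r v N
    by (rule exists_separated_far) (use sym V cut that in blast)+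
  define r where "r = a"
  have r: "r \<in> ?V" using a r_def by simp
  obtain b where "b \<in> ?V" "b \<noteq> r" using inf
    by (metis finite.emptyI finite_insert finite_subset insertI1 subsetI singletonI)
  then obtain s where s: "(r, s) \<in> ?E" using V[OF r, of b] by (metis converse_rtranclE)
  have s': "s \<in> ?V" "r \<noteq> s"
    using s parcs_subset[OF G] pair_loopfree_digraph.no_loops'[of G s] G
      pair_bidirected_digraph.axioms(2) by blast+
  define v where "v = from_nat_into ?V"
  have v: "range v = ?V" unfolding v_def
    using inf assms(2) by (intro range_from_nat_into) auto
  let ?d = "rel_dist ?E r"
  \<comment> \<open>Dependent choice compares consecutive terms only; \<open>gap\<close> below
    extends this to all pairs.\<close>
  have "\<exists>u. \<forall>n. (u n \<in> ?V \<and> separates ?E r (v n) (u n) \<and> 2 < ?d (u n)) \<and> Suc (?d (u n)) < ?d (u (Suc n))"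
  proof (rule dependent_nat_choice)
    show "\<exists>x. x \<in> ?V \<and> separates ?E r (v 0) x \<and> 2 < ?d x"
      using far[OF r, of "v 0" 3] v by (metis Suc_le_eq numeral_3_eq_3 numeral_2_eq_2 rangeI)
    fix x n assume "x \<in> ?V \<and> separates ?E r (v n) x \<and> 2 < ?d x"
    then show "\<exists>y. (y \<in> ?V \<and> separates ?E r (v (Suc n)) y \<and> 2 < ?d y) \<and> Suc (?d x) < ?d y"
      using far[OF r, of "v (Suc n)" "?d x + 2"] v by fastforce
  qed
  then obtain u where u: "\<And>n. u n \<in> ?V" "\<And>n. separates ?E r (v n) (u n)" "\<And>n. 2 < ?d (u n)"
    and step: "\<And>n. Suc (?d (u n)) < ?d (u (Suc n))" by blast
  have gap: "Suc (?d (u m)) < ?d (u n)" if "m < n" for m n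
    using that
  proof (induction n)
    case (Suc n)
    then show ?case using step[of n] by (cases "m = n") auto
  qed simp
  define B where "B = {r, s} \<union> range u"
  have B: "B \<subseteq> ?V" using r s' u(1) by (auto simp: B_def)
  define c :: "'a \<Rightarrow> nat" where "c x = of_bool (x \<in> B)" for x
  have "distinguishing_coloring G c"
    unfolding distinguishing_coloring_def
  proof (intro allI impI, elim conjE)
    fix f assume f: "automorphism G f" and pres: "\<forall>i. f ` {x \<in> ?V. c x = i} = {x \<in> ?V. c x = i}"
    have "{x \<in> ?V. c x = 1} = B" using B by (auto simp: c_def)
    with pres have black: "f ` B = B" by metis
    have "f x = x" if "x \<in> ?V" for x
      by (rule black_vertices_rigid[of ?V ?E r s v u f])
        (use V sym r s s' v u gap rel_automorphism_parcs[OF G f] black that in \<open>auto simp: B_def\<close>)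
    moreover have "f x = x" if "x \<notin> ?V" for x
      using f that by (auto simp: automorphism_def dest: permutes_not_in)
    ultimately show "f = id" by (auto simp: fun_eq_iff)
  qed
  moreover have "c ` ?V \<subseteq> {..<2}" by (auto simp: c_def)
  ultimately show ?thesis by blast
qed

theorem theorem3:
  fixes G :: "'a pair_pre_digraph"
  assumes "pair_bidirected_digraph G"
    and "countable (pverts G)" and "infinite (pverts G)"
    and "vertex_transitive G"
    and "connectivity_one G"
  shows "distinguishing_number G = 2"
proof (rule antisym)
  show "distinguishing_number G \<le> 2"
    unfolding distinguishing_number_def
    using exists_distinguishing_2_coloring[OF assms]
    by (intro Inf_lower) (auto intro!: exI[of _ 2] simp: numeral_eq_enat)
  show "2 \<le> distinguishing_number G"
    unfolding distinguishing_number_def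
  proof (rule Inf_greatest, safe)
    fix k and c :: "'a \<Rightarrow> nat"
    assume k: "c ` pverts G \<subseteq> {..<k}" and c: "distinguishing_coloring G c"
    obtain x where x: "x \<in> pverts G" using assms(3) by (metis finite.emptyI equals0I)
    obtain y where y: "y \<in> pverts G" "y \<noteq> x"
      using assms(3) by (metis finite.emptyI finite_insert finite_subset insertI1 subsetI)
    \<comment> \<open>This \<open>f\<close> is not the identity. With fewer than two colors every
      color class is empty or the whole vertex set, so \<open>f\<close> would preserve it.\<close>
    obtain f where f: "automorphism G f" "f x = y"
      using assms(4) x y unfolding vertex_transitive_def by blast
    have "2 \<le> k"
    proof (rule ccontr)
      assume "\<not> 2 \<le> k"
      with k have c0: "c z = 0" if "z \<in> pverts G" for z using that by force
      have "f ` pverts G = pverts G" using f(1) by (auto simp: automorphism_def permutes_image)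
      then have "f ` {v \<in> pverts G. c v = i} = {v \<in> pverts G. c v = i}" for i
        using c0 by (cases "i = 0") auto
      with c f(1) have "f = id" by (auto simp: distinguishing_coloring_def)
      with f(2) y show False by simp
    qed
    then show "2 \<le> enat k" by (simp add: numeral_eq_enat)
  qed
qed

end
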